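(* (Hölder's inequality.) Let $\mathbb{T}$ be a time scale and let $a,b\in\mathbb{T}$ with $a<b$. Let $h\in C_{rd}([a,b]_{\mathbb{T}},(0,\infty))$ and $f,g\in C_{rd}([a,b]_{\mathbb{T}},\mathbb{R}_{\mathcal{I}}^{+})$. If $\frac1p+\frac1q=1$, with $p>1$, then $$\int_a^b h(s)f(s)g(s)\Delta s\le\Bigg(\int_a^b h(s)f^{p}(s)\Delta s\Bigg)^{\frac1p}\Bigg(\int_a^b h(s)g^{q}(s)\Delta s\Bigg)^{\frac1q},$$ where the integrals are $IR$ $\Delta$-integrals of interval-valued functions and $\le$ is the partial order on intervals.
   Context: A time scale $\mathbb{T}$ is a nonempty closed subset of $\mathbb{R}$. For $a,b\in\mathbb{T}$, $[a,b]_{\mathbb{T}}=\{t\in\mathbb{T}:a\le t\le b\}$ and $[a,b)_{\mathbb{T}}=\{t\in\mathbb{T}:a\le t<b\}$. Put $\sigma(t)=\inf\{s\in\mathbb{T}:s>t\}$ and $\rho(t)=\sup\{s\in\mathbb{T}:s<t\}$ (with $\sigma(\sup\mathbb{T})=\sup\mathbb{T}$, $\rho(\inf\mathbb{T})=\inf\mathbb{T}$ when finite). A point $t$ is right-dense if $\sigma(t)=t<\sup\mathbb{T}$ and left-dense if $\rho(t)=t>\inf\mathbb{T}$. $\mathbb{R}_{\mathcal{I}}$ is the set of nonempty compact intervals $[\underline{u},\overline{u}]\subset\mathbb{R}$, $\underline{u}\le\overline{u}$ (degenerate intervals allowed); $\mathbb{R}^+_{\mathcal{I}}$ is the subset with $\underline{u}>0$.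 The metric is $d([\underline{u},\overline{u}],[\underline{v},\overline{v}])=\max\{|\underline{u}-\underline{v}|,|\overline{u}-\overline{v}|\}$. Partial order: $[\underline{u},\overline{u}]\le[\underline{v},\overline{v}]$ iff $\underline{u}\le\underline{v}$ and $\overline{u}\le\overline{v}$. Operations: $[\underline{u},\overline{u}]+[\underline{v},\overline{v}]=[\underline{u}+\underline{v},\overline{u}+\overline{v}]$; $\lambda[\underline{u},\overline{u}]=[\lambda\underline{u},\lambda\overline{u}]$ for $\lambda>0$; $[\underline{u},\overline{u}]\cdot[\underline{v},\overline{v}]=[\min P,\max P]$ with $P=\{\underline{u}\,\underline{v},\underline{u}\,\overline{v},\overline{u}\,\underline{v},\overline{u}\,\overline{v}\}$; for $\underline{u}\ge0$ and real $r>0$, $[\underline{u},\overline{u}]^r=[\underline{u}^r,\overline{u}^r]$. Operations on functions are pointwise. A function on $[a,b]_{\mathbb{T}}$ with values in $\mathbb{R}$ (or in $\mathbb{R}_{\mathcal{I}}$ with metric $d$) is $rd$-continuous if it is right continuous at each right-dense point and has a finite left limit at each left-dense point; in the interval-valued case this means that both endpoint functions are $rd$-continuous. $C_{rd}([a,b]_{\mathbb{T}},X)$ is the set of $rd$-continuous functions taking values in $X$. A division of $[a,b]_{\mathbb{T}}$ is a finite set $D=\{a=t_0<\cdots<t_n=b\}\subseteq[a,b]_{\mathbb{T}}$. For $\delta>0$, $\mathcal{D}(\delta,[a,b]_{\mathbb{T}})$ is the (nonempty) set of divisions such that for each $i$ either $t_i-t_{i-1}\le\delta$, or $t_i-t_{i-1}>\delta$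 and $\rho(t_i)=t_{i-1}$. A Riemann $\Delta$-sum of $F:[a,b]_{\mathbb{T}}\to\mathbb{R}_{\mathcal{I}}$ is $S(F,D,\delta)=\sum_{i=1}^nF(\xi_i)(t_i-t_{i-1})$ with $D\in\mathcal{D}(\delta,[a,b]_{\mathbb{T}})$ and arbitrary $\xi_i\in[t_{i-1},t_i)_{\mathbb{T}}$. $F$ is $IR$ $\Delta$-integrable with integral $A=(IR)\int_a^bF(t)\Delta t\in\mathbb{R}_{\mathcal{I}}$ (written here $\int_a^bF(t)\Delta t$) if for every $\epsilon>0$ there is $\delta>0$ with $d(S(F,D,\delta),A)<\epsilon$ for all $D\in\mathcal{D}(\delta,[a,b]_{\mathbb{T}})$ and all choices of $\xi_i$. *)

theory Defs
  imports "HOL-Analysis.Analysis" "HOL-Library.Interval"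
begin

section \<open>Time scales\<close>

definition time_scale :: "real set \<Rightarrow> bool" where
  "time_scale T \<longleftrightarrow> T \<noteq> {} \<and> closed T"

definition ts_Icc :: "real set \<Rightarrow> real \<Rightarrow> real \<Rightarrow> real set" where
  "ts_Icc T a b = {t \<in> T. a \<le> t \<and> t \<le> b}"

definition ts_Ico :: "real set \<Rightarrow> real \<Rightarrow> real \<Rightarrow> real set" where
  "ts_Ico T a b = {t \<in> T. a \<le> t \<and> t < b}"

text \<open>For \<open>t \<in> T\<close>, no point of \<open>T\<close> lies strictly above \<open>t\<close> iff \<open>t\<close> is the (finite) supremum of
  \<open>T\<close>; so the \<open>else\<close> branches below are the conventions at \<open>sup T\<close> and \<open>inf T\<close>, and
  \<open>\<exists>s\<in>T. t < s\<close> expresses \<open>t < sup T\<close> also when the supremum is infinite. Dually below \<open>t\<close>.\<close>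

definition ts_sigma :: "real set \<Rightarrow> real \<Rightarrow> real" where
  "ts_sigma T t = (if \<exists>s\<in>T. t < s then Inf {s \<in> T. t < s} else t)"

definition ts_rho :: "real set \<Rightarrow> real \<Rightarrow> real" where
  "ts_rho T t = (if \<exists>s\<in>T. s < t then Sup {s \<in> T. s < t} else t)"

definition right_dense :: "real set \<Rightarrow> real \<Rightarrow> bool" where
  "right_dense T t \<longleftrightarrow> ts_sigma T t = t \<and> (\<exists>s\<in>T. t < s)"

definition left_dense :: "real set \<Rightarrow> real \<Rightarrow> bool" where
  "left_dense T t \<longleftrightarrow> ts_rho T t = t \<and> (\<exists>s\<in>T. s < t)"


section \<open>Compact real intervals\<close>

text \<open>The library type \<^typ>\<open>real interval\<close> consists of the nonempty compact real intervals, and its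
  \<open>+\<close> and \<open>*\<close> are the usual interval sum and product. Its \<open>\<le>\<close>, however, is inclusion, so the
  endpointwise order is introduced separately.\<close>

definition ivl_le :: "real interval \<Rightarrow> real interval \<Rightarrow> bool" (infix \<open>\<le>\<^sub>I\<close> 50) where
  "X \<le>\<^sub>I Y \<longleftrightarrow> lower X \<le> lower Y \<and> upper X \<le> upper Y"

definition ivl_dist :: "real interval \<Rightarrow> real interval \<Rightarrow> real" where
  "ivl_dist X Y = max \<bar>lower X - lower Y\<bar> \<bar>upper X - upper Y\<bar>"

definition positive_ivls :: "real interval set" where
  "positive_ivls = {X. 0 < lower X}"

text \<open>\<open>Interval (x, y)\<close> is meaningful only for \<open>x \<le> y\<close>. Hence scaling is meaningful for
  nonnegative factors, and the power for positive exponents and a nonnegative lower endpoint.\<close>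

definition ivl_scale :: "real \<Rightarrow> real interval \<Rightarrow> real interval" (infixr \<open>*\<^sub>I\<close> 75) where
  "c *\<^sub>I X = Interval (c * lower X, c * upper X)"

definition ivl_powr :: "real interval \<Rightarrow> real \<Rightarrow> real interval" (infixr \<open>powr\<^sub>I\<close> 80) where
  "X powr\<^sub>I r = Interval (lower X powr r, upper X powr r)"

lemma lower_upper_Interval:
  fixes x y :: "'a::preorder"
  assumes "x \<le> y"
  shows "lower (Interval (x, y)) = x" "upper (Interval (x, y)) = y"
  using assms by (simp_all add: lower.rep_eq upper.rep_eq Interval_inverse)

lemma lower_upper_ivl_scale [simp]:
  assumes "0 \<le> c"
  shows "lower (c *\<^sub>I X) = c * lower X" "upper (c *\<^sub>I X) = c * upper X"
  using assms by (simp_all add: ivl_scale_def lower_upper_Interval mult_left_mono)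

lemma lower_upper_ivl_powr [simp]:
  assumes "0 \<le> lower X" "0 < r"
  shows "lower (X powr\<^sub>I r) = lower X powr r" "upper (X powr\<^sub>I r) = upper X powr r"
  using assms by (simp_all add: ivl_powr_def lower_upper_Interval powr_mono2)


section \<open>Rd-continuity\<close>

text \<open>Functions on \<open>ts_Icc T a b\<close> are total functions whose values elsewhere are irrelevant: all limits
  are taken within \<open>ts_Icc T a b\<close>. In particular the conditions are vacuous on the right of \<open>b\<close>
  and on the left of \<open>a\<close>.\<close>

definition rd_continuous :: "real set \<Rightarrow> real \<Rightarrow> real \<Rightarrow> (real \<Rightarrow> real) \<Rightarrow> bool" where
  "rd_continuous T a b f \<longleftrightarrow>
     (\<forall>t\<in>ts_Icc T a b.
        (right_dense T t \<longrightarrow> (f \<longlongrightarrow> f t) (at t within (ts_Icc T a b \<inter> {t<..}))) \<and>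
        (left_dense T t \<longrightarrow> (\<exists>l. (f \<longlongrightarrow> l) (at t within (ts_Icc T a b \<inter> {..<t})))))"

definition C_rd :: "real set \<Rightarrow> real \<Rightarrow> real \<Rightarrow> real set \<Rightarrow> (real \<Rightarrow> real) set" where
  "C_rd T a b X = {f. rd_continuous T a b f \<and> (\<forall>t\<in>ts_Icc T a b. f t \<in> X)}"

definition C_rd_ivl ::
  "real set \<Rightarrow> real \<Rightarrow> real \<Rightarrow> real interval set \<Rightarrow> (real \<Rightarrow> real interval) set" where
  "C_rd_ivl T a b X =
     {F. rd_continuous T a b (\<lambda>t. lower (F t)) \<and> rd_continuous T a b (\<lambda>t. upper (F t)) \<and>
         (\<forall>t\<in>ts_Icc T a b. F t \<in> X)}"


section \<open>The interval-valued Riemann delta integral\<close>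

text \<open>A division \<open>a = t 0 < \<dots> < t n = b\<close> is given by \<open>n\<close> and its enumeration \<open>t\<close>, of which only the
  values on \<open>{..n}\<close> matter. The tag \<open>\<xi> i\<close> lies in the \<open>i\<close>-th subinterval, for \<open>1 \<le> i \<le> n\<close>.\<close>

definition ts_division :: "real set \<Rightarrow> real \<Rightarrow> real \<Rightarrow> nat \<Rightarrow> (nat \<Rightarrow> real) \<Rightarrow> bool" where
  "ts_division T a b n t \<longleftrightarrow>
     t 0 = a \<and> t n = b \<and> (\<forall>i\<in>{1..n}. t (i - 1) < t i) \<and> (\<forall>i\<le>n. t i \<in> ts_Icc T a b)"

definition fine_division ::
  "real set \<Rightarrow> real \<Rightarrow> real \<Rightarrow> real \<Rightarrow> nat \<Rightarrow> (nat \<Rightarrow> real) \<Rightarrow> bool" where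
  "fine_division T a b \<delta> n t \<longleftrightarrow>
     ts_division T a b n t \<and>
     (\<forall>i\<in>{1..n}. t i - t (i - 1) \<le> \<delta> \<or> (t i - t (i - 1) > \<delta> \<and> ts_rho T (t i) = t (i - 1)))"

definition delta_sum ::
  "(real \<Rightarrow> real interval) \<Rightarrow> nat \<Rightarrow> (nat \<Rightarrow> real) \<Rightarrow> (nat \<Rightarrow> real) \<Rightarrow> real interval" where
  "delta_sum F n t \<xi> = (\<Sum>i\<in>{1..n}. (t i - t (i - 1)) *\<^sub>I F (\<xi> i))"

definition has_IR_integral ::
  "real set \<Rightarrow> real \<Rightarrow> real \<Rightarrow> (real \<Rightarrow> real interval) \<Rightarrow> real interval \<Rightarrow> bool" where
  "has_IR_integral T a b F A \<longleftrightarrow>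
     (\<forall>\<epsilon>>0. \<exists>\<delta>>0. \<forall>n t \<xi>.
        fine_division T a b \<delta> n t \<longrightarrow> (\<forall>i\<in>{1..n}. \<xi> i \<in> ts_Ico T (t (i - 1)) (t i)) \<longrightarrow>
        ivl_dist (delta_sum F n t \<xi>) A < \<epsilon>)"

definition IR_integrable ::
  "real set \<Rightarrow> real \<Rightarrow> real \<Rightarrow> (real \<Rightarrow> real interval) \<Rightarrow> bool" where
  "IR_integrable T a b F \<longleftrightarrow> (\<exists>A. has_IR_integral T a b F A)"

definition IR_integral ::
  "real set \<Rightarrow> real \<Rightarrow> real \<Rightarrow> (real \<Rightarrow> real interval) \<Rightarrow> real interval" where
  "IR_integral T a b F = (THE A. has_IR_integral T a b F A)"

end

theory Submission
  imports Defs
begin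

text \<open>
  For intervals with nonnegative lower endpoints, the product, the powers with positive exponent
  and the scaling by a nonnegative real all act separately on lower and on upper endpoints, and so
  do the order and the integral. The claim is therefore Hoelder's inequality for the real functions
  formed by the lower endpoints, together with the same inequality for the upper endpoints
  (\<open>tag_sum_limit_Holder\<close>). For a single Riemann delta-sum it is the weighted Hoelder inequality for
  finite sums, \<open>Holder_inequality_sum\<close>, with the nonnegative weights
  \<open>(t i - t (i - 1)) * h (\<xi> i)\<close>, and it survives the passage to the limit.

  To make such limits available, the tagged divisions are organised as a filter \<open>delta_sums\<close>, so
  that integrability means convergence of the sums along this filter. Two facts need work. The
  filter is nontrivial, that is, arbitrarily fine divisions exist (\<open>fine_division_exists\<close>); this
  makes integrals unique and lets inequalities pass to the limit. And the delta-sums of a real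
  rd-continuous function \<open>f\<close> converge (\<open>tag_sum_tendsto\<close>). For the latter, extend \<open>f\<close> from the time
  scale to the real line by keeping it constant on each gap. Rd-continuity says
  exactly that the extension \<open>F\<close> is right continuous with left limits, so it is bounded and
  integrable over \<open>{a..b}\<close> and, up to any \<open>e > 0\<close>, is constant between finitely many cut points. A delta-sum
  of \<open>f\<close> is a Riemann sum of \<open>F\<close>: the cells of a fine division that are not short span gaps, where
  the sum is exact; short cells without a cut point contribute errors of total size at most
  \<open>e * (b - a)\<close>; and the short cells with a cut point are boundedly many, so that their
  contribution vanishes with the mesh. Hence the limit is the ordinary integral of \<open>F\<close>.
\<close>

section \<open>Right continuous functions with left limits\<close>

definition cadlag :: "(real \<Rightarrow> real) \<Rightarrow> bool" where
  "cadlag F \<longleftrightarrow> (\<forall>x. (F \<longlongrightarrow> F x) (at_right x) \<and> (\<exists>l. (F \<longlongrightarrow> l) (at_left x)))"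

text \<open>Both one-sided limits are used through one common radius. The left limit \<open>l\<close> may differ
  from \<open>F x\<close>, so the two sides of \<open>x\<close> need separate estimates.\<close>

lemma cadlag_near:
  assumes "cadlag F" "0 < e"
  obtains d l where "0 < d"
    "\<And>y. x \<le> y \<Longrightarrow> y < x + d \<Longrightarrow> \<bar>F y - F x\<bar> < e"
    "\<And>y. x - d < y \<Longrightarrow> y < x \<Longrightarrow> \<bar>F y - l\<bar> < e"
proof -
  obtain l where l: "(F \<longlongrightarrow> l) (at_left x)" and r: "(F \<longlongrightarrow> F x) (at_right x)"
    using assms(1) unfolding cadlag_def by blast
  from tendstoD[OF r assms(2)] obtain u where u: "x < u" "\<And>y. x < y \<Longrightarrow> y < u \<Longrightarrow> \<bar>F y - F x\<bar> < e"
    by (auto simp: eventually_at_right_field dist_real_def)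
  from tendstoD[OF l assms(2)] obtain v where v: "v < x" "\<And>y. v < y \<Longrightarrow> y < x \<Longrightarrow> \<bar>F y - l\<bar> < e"
    by (auto simp: eventually_at_left_field dist_real_def)
  show thesis
  proof (rule that[of "min (u - x) (x - v)" l])
    show "\<bar>F y - F x\<bar> < e" if "x \<le> y" "y < x + min (u - x) (x - v)" for y
      using that u(2)[of y] assms(2) by (cases "y = x") auto
  qed (use u v in auto)
qed

text \<open>Near each point \<open>F\<close> is within \<open>1\<close> of one of two values; Bolzano's principle (a property of
  intervals that holds locally and is inherited by the union of adjacent intervals holds globally)
  turns this into a bound on \<open>{a..b}\<close>. The next two lemmas use the same principle.\<close>

lemma cadlag_bounded:
  assumes "cadlag F" "a \<le> b"
  obtains M where "0 \<le> M" "\<And>x. x \<in> {a..b} \<Longrightarrow> \<bar>F x\<bar> \<le> M"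
proof -
  have "\<exists>M. \<forall>x\<in>{a..b}. \<bar>F x\<bar> \<le> M"
    using assms(2)
  proof (induction rule: Bolzano)
    case (trans a b c)
    then obtain M N where M: "\<forall>x\<in>{a..b}. \<bar>F x\<bar> \<le> M" and N: "\<forall>x\<in>{b..c}. \<bar>F x\<bar> \<le> N"
      by blast
    show ?case
    proof (intro exI ballI)
      fix x assume "x \<in> {a..c}"
      then show "\<bar>F x\<bar> \<le> max M N"
        using M N by (cases "x \<le> b") (auto simp: le_max_iff_disj)
    qed
  next
    case (local x)
    obtain d l where d: "0 < d" 
      "\<And>y. x \<le> y \<Longrightarrow> y < x + d \<Longrightarrow> \<bar>F y - F x\<bar> < 1"
      "\<And>y. x - d < y \<Longrightarrow> y < x \<Longrightarrow> \<bar>F y - l\<bar> < 1"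
      using cadlag_near[OF assms(1), of 1] by auto
    have "\<bar>F y\<bar> \<le> \<bar>F x\<bar> + \<bar>l\<bar> + 1" if "u \<le> x" "x \<le> v" "v - u < d" "y \<in> {u..v}" for u v y
      using that d(2,3)[of y] by (cases "x \<le> y") auto
    with d(1) show ?case by blast
  qed
  then obtain M where M: "\<And>x. x \<in> {a..b} \<Longrightarrow> \<bar>F x\<bar> \<le> M" by blast
  moreover have "0 \<le> M" using M[of a] assms(2) by auto
  ultimately show thesis using that by blast
qed

text \<open>Among the points of \<open>S\<close> are all jumps of \<open>F\<close> by more than \<open>e\<close> strictly between \<open>a\<close> and \<open>b\<close>.
  The cells are half-open because a jump at the right end \<open>v\<close> must not count; this matches the
  half-open range of the tags of a division.\<close>

lemma cadlag_small_oscillation: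
  assumes "cadlag F" "a \<le> b" "0 < e"
  obtains S where "finite S"
    "\<And>u v z w. a \<le> u \<Longrightarrow> v \<le> b \<Longrightarrow> {u<..<v} \<inter> S = {} \<Longrightarrow> z \<in> {u..<v} \<Longrightarrow> w \<in> {u..<v}
       \<Longrightarrow> \<bar>F z - F w\<bar> \<le> e"
proof -
  have "\<exists>S. finite S \<and> (\<forall>u v. a \<le> u \<longrightarrow> v \<le> b \<longrightarrow> {u<..<v} \<inter> S = {} \<longrightarrow>
          (\<forall>z\<in>{u..<v}. \<forall>w\<in>{u..<v}. \<bar>F z - F w\<bar> \<le> e))"
    using assms(2)
  proof (induction rule: Bolzano)
    case (trans a c b)
    then obtain S1 S2 where S1: "finite S1" "\<forall>u v. a \<le> u \<longrightarrow> v \<le> c \<longrightarrow> {u<..<v} \<inter> S1 = {} \<longrightarrow>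
          (\<forall>z\<in>{u..<v}. \<forall>w\<in>{u..<v}. \<bar>F z - F w\<bar> \<le> e)"
      and S2: "finite S2" "\<forall>u v. c \<le> u \<longrightarrow> v \<le> b \<longrightarrow> {u<..<v} \<inter> S2 = {} \<longrightarrow>
          (\<forall>z\<in>{u..<v}. \<forall>w\<in>{u..<v}. \<bar>F z - F w\<bar> \<le> e)"
      by blast
    show ?case
    proof (intro exI[of _ "insert c (S1 \<union> S2)"] conjI allI impI)
      fix u v assume uv: "a \<le> u" "v \<le> b" "{u<..<v} \<inter> insert c (S1 \<union> S2) = {}"
      then consider "v \<le> c" | "c \<le> u" by force
      then show "\<forall>z\<in>{u..<v}. \<forall>w\<in>{u..<v}. \<bar>F z - F w\<bar> \<le> e"
      proof cases
        case 1
        with uv show ?thesis by (intro S1(2)[rule_format] ballI) auto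
      next
        case 2
        with uv show ?thesis by (intro S2(2)[rule_format] ballI) auto
      qed
    qed (use S1 S2 in auto)
  next
    case (local x)
    obtain d l where d: "0 < d" 
      "\<And>y. x \<le> y \<Longrightarrow> y < x + d \<Longrightarrow> \<bar>F y - F x\<bar> < e/2"
      "\<And>y. x - d < y \<Longrightarrow> y < x \<Longrightarrow> \<bar>F y - l\<bar> < e/2"
      using cadlag_near[OF assms(1), of "e/2"] assms(3) by auto
 have osc: "\<bar>F z - F w\<bar> \<le> e"
      if "a \<le> x" "x \<le> b" "b - a < d" "a \<le> u" "v \<le> b" "{u<..<v} \<inter> {x} = {}"
        "z \<in> {u..<v}" "w \<in> {u..<v}" for a b u v z w
    proof -
      from that consider "v \<le> x" | "x \<le> u" by force
      then show ?thesis
      proof cases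
        case 1
        then have "\<bar>F z - l\<bar> < e/2" "\<bar>F w - l\<bar> < e/2" using that by (intro d(3); auto)+
        then show ?thesis by linarith
      next
        case 2
        then have "\<bar>F z - F x\<bar> < e/2" "\<bar>F w - F x\<bar> < e/2" using that by (intro d(2); auto)+
        then show ?thesis by linarith
      qed
    qed
    with d(1) show ?case
      by (intro exI[of _ d] conjI allI impI exI[of _ "{x}"] ballI) (simp, simp, (elim conjE, rule osc))
  qed
  then obtain S where S: "finite S"
    and osc: "\<forall>u v. a \<le> u \<longrightarrow> v \<le> b \<longrightarrow> {u<..<v} \<inter> S = {} \<longrightarrow>
          (\<forall>z\<in>{u..<v}. \<forall>w\<in>{u..<v}. \<bar>F z - F w\<bar> \<le> e)"
    by (elim exE conjE)
  show thesis by (rule that[OF S osc[rule_format]])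
qed

text \<open>Near each point \<open>F\<close> is uniformly close to a function with a single jump, so on
  \<open>{a..b}\<close> it is a uniform limit of integrable functions.\<close>

lemma cadlag_integrable:
  assumes "cadlag F" "a \<le> b"
  shows "F integrable_on {a..b}"
proof (rule integrable_uniform_limit_real)
  fix e :: real assume e: "0 < e"
  show "\<exists>g. (\<forall>x\<in>{a..b}. norm (F x - g x) \<le> e) \<and> g integrable_on {a..b}"
    using assms(2)
  proof (induction rule: Bolzano)
    case (trans a c b)
    then obtain g1 g2 where g1: "\<forall>x\<in>{a..c}. norm (F x - g1 x) \<le> e" "g1 integrable_on {a..c}"
      and g2: "\<forall>x\<in>{c..b}. norm (F x - g2 x) \<le> e" "g2 integrable_on {c..b}"
      by blast
    let ?g = "\<lambda>x. if x \<le> c then g1 x else g2 x"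
    have "?g integrable_on {a..c}"
      using g1(2) by (rule integrable_spike_finite[of "{}", rotated 2]) auto
    moreover have "?g integrable_on {c..b}"
      using g2(2) by (rule integrable_spike_finite[of "{c}", rotated 2]) auto
    ultimately have "?g integrable_on {a..b}"
      using \<open>a \<le> c\<close> \<open>c \<le> b\<close> by (rule Henstock_Kurzweil_Integration.integrable_combine[rotated 2])
    then show ?case using g1 g2 by (intro exI[of _ ?g]) auto
  next
    case (local x)
    obtain d l where d: "0 < d" 
      "\<And>y. x \<le> y \<Longrightarrow> y < x + d \<Longrightarrow> \<bar>F y - F x\<bar> < e"
      "\<And>y. x - d < y \<Longrightarrow> y < x \<Longrightarrow> \<bar>F y - l\<bar> < e"
      using cadlag_near[OF assms(1) e] by auto
    let ?g = "\<lambda>y. if y < x then l else F x"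
    have "?g integrable_on {u..v}" if "u \<le> x" "x \<le> v" for u v
    proof -
      have "?g integrable_on {u..x}"
        using integrable_const_ivl[of l u x] by (rule integrable_spike_finite[of "{x}", rotated 2]) auto
      moreover have "?g integrable_on {x..v}"
        using integrable_const_ivl[of "F x" x v] by (rule integrable_spike_finite[of "{}", rotated 2]) auto
      ultimately show ?thesis
        using that by (rule Henstock_Kurzweil_Integration.integrable_combine[rotated 2])
    qed
    moreover have "norm (F y - ?g y) \<le> e" if "u \<le> x" "x \<le> v" "v - u < d" "y \<in> {u..v}" for u v y
      using that d(2,3)[of y] by (cases "x \<le> y") auto
    ultimately show ?case
      using d(1) by (intro exI[of _ d] conjI allI impI exI[of _ ?g] ballI) blast+
  qed
qed

lemma integral_minus_tag_bound:
  fixes F :: "real \<Rightarrow> real"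
  assumes "F integrable_on {u..v}" "u \<le> v" "0 \<le> B" "\<And>w. w \<in> {u..<v} \<Longrightarrow> \<bar>F w - c\<bar> \<le> B"
  shows "\<bar>(v - u) * c - integral {u..v} F\<bar> \<le> B * (v - u)"
proof -
  have "((\<lambda>w. F w - c) has_integral (integral {u..v} F - (v - u) * c)) {u..v}"
    using has_integral_diff[OF integrable_integral[OF assms(1)] has_integral_const_real[of c u v]] assms(2)
    by simp
  then have "norm (integral {u..v} F - (v - u) * c) \<le> B * measure lborel {u..v}"
    by (rule has_integral_bound_spike_finite[of B "{v}", rotated 2, unfolded box_real]) (use assms in auto)
  then show ?thesis using assms(2) by (simp add: abs_minus_commute)
qed

section \<open>Extending functions from a time scale to the real line\<close>

locale ts_segment =
  fixes T :: "real set" and a b :: real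
  assumes ts: "time_scale T" and a_in: "a \<in> T" and b_in: "b \<in> T" and a_le_b: "a \<le> b"
begin

text \<open>The last point of the segment that is not beyond \<open>x\<close>. Inserting \<open>a\<close> gives the value \<open>a\<close> to the
  points left of the segment, so that \<open>f \<circ> ts_floor\<close> is defined on the whole line and is constant
  outside \<open>{a..b}\<close>.\<close>

definition ts_floor :: "real \<Rightarrow> real" where
  "ts_floor x = Sup (insert a {s \<in> ts_Icc T a b. s \<le> x})"

lemma ts_floor_in: "ts_floor x \<in> insert a {s \<in> ts_Icc T a b. s \<le> x}"
  unfolding ts_floor_def
proof (rule closed_contains_Sup)
  have "{s \<in> ts_Icc T a b. s \<le> x} = T \<inter> {a..min b x}"
    by (auto simp: ts_Icc_def)
  then show "closed (insert a {s \<in> ts_Icc T a b. s \<le> x})"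
    using ts by (auto simp: time_scale_def intro!: closed_insert)
  show "bdd_above (insert a {s \<in> ts_Icc T a b. s \<le> x})"
    using a_le_b by (intro bdd_aboveI[of _ b]) (auto simp: ts_Icc_def)
qed simp

lemma ts_floor_mem: "ts_floor x \<in> ts_Icc T a b"
  using ts_floor_in[of x] a_in a_le_b by (auto simp: ts_Icc_def)

lemma ts_floor_le: "a \<le> x \<Longrightarrow> ts_floor x \<le> x"
  using ts_floor_in[of x] by auto

lemma ts_floor_ge: "s \<in> ts_Icc T a b \<Longrightarrow> s \<le> x \<Longrightarrow> s \<le> ts_floor x"
  unfolding ts_floor_def
  by (rule cSup_upper) (auto intro!: bdd_aboveI[of _ "max a x"])

lemma ts_floor_eqI:
  assumes "s \<in> ts_Icc T a b" "s \<le> x" "ts_Icc T a b \<inter> {s<..x} = {}"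
  shows "ts_floor x = s"
proof -
  have "ts_floor x \<le> x" using assms by (intro ts_floor_le) (auto simp: ts_Icc_def)
  then show ?thesis using ts_floor_ge[OF assms(1,2)] ts_floor_mem[of x] assms(3)
    by (metis IntI empty_iff greaterThanAtMost_iff order_le_imp_less_or_eq)
qed

lemma ts_floor_id: "s \<in> ts_Icc T a b \<Longrightarrow> ts_floor s = s"
  by (rule ts_floor_eqI) auto

lemma ts_floor_eq:
  assumes "u \<le> v" "ts_Icc T a b \<inter> {u<..v} = {}"
  shows "ts_floor u = ts_floor v"
proof -
  have "{s \<in> ts_Icc T a b. s \<le> u} = {s \<in> ts_Icc T a b. s \<le> v}"
    using assms by force
  then show ?thesis by (simp add: ts_floor_def)
qed

lemma accumulation_mem:
  assumes "\<And>e. 0 < e \<Longrightarrow> \<exists>s \<in> ts_Icc T a b. \<bar>s - x\<bar> < e"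
  shows "x \<in> ts_Icc T a b"
proof -
  have "ts_Icc T a b = T \<inter> {a..b}" by (auto simp: ts_Icc_def)
  then have "closed (ts_Icc T a b)" using ts by (auto simp: time_scale_def)
  moreover have "x \<in> closure (ts_Icc T a b)"
    using assms by (simp add: closure_approachable dist_real_def)
  ultimately show ?thesis by simp
qed

lemma right_dense_accumulation:
  assumes "\<And>e. 0 < e \<Longrightarrow> \<exists>s \<in> ts_Icc T a b. x < s \<and> s < x + e"
  shows "right_dense T x"
proof -
  have ex: "\<exists>s\<in>T. x < s" using assms[of 1] by (auto simp: ts_Icc_def)
  have "Inf {s \<in> T. x < s} = x"
  proof (rule cInf_eq_non_empty)
    show "y \<le> x" if "\<And>s. s \<in> {s \<in> T. x < s} \<Longrightarrow> y \<le> s" for y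
    proof (rule ccontr)
      assume "\<not> y \<le> x"
      then obtain s where "s \<in> ts_Icc T a b" "x < s" "s < y" using assms[of "y - x"] by auto
      then show False using that[of s] by (auto simp: ts_Icc_def)
    qed
  qed (use ex in auto)
  then show ?thesis using ex by (simp add: right_dense_def ts_sigma_def)
qed

lemma left_dense_accumulation:
  assumes "\<And>e. 0 < e \<Longrightarrow> \<exists>s \<in> ts_Icc T a b. x - e < s \<and> s < x"
  shows "left_dense T x"
proof -
  have ex: "\<exists>s\<in>T. s < x" using assms[of 1] by (auto simp: ts_Icc_def)
  have "Sup {s \<in> T. s < x} = x"
  proof (rule cSup_eq_non_empty)
    show "x \<le> y" if "\<And>s. s \<in> {s \<in> T. s < x} \<Longrightarrow> s \<le> y" for y
    proof (rule ccontr)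
      assume "\<not> x \<le> y"
      then obtain s where "s \<in> ts_Icc T a b" "y < s" "s < x" using assms[of "x - y"] by auto
      then show False using that[of s] by (auto simp: ts_Icc_def)
    qed
  qed (use ex in auto)
  then show ?thesis using ex by (simp add: left_dense_def ts_rho_def)
qed

text \<open>If no point of the segment lies close to \<open>x\<close> on one side, then \<open>ts_floor\<close> is constant on that
  side near \<open>x\<close>. Otherwise \<open>x\<close> is a point of the segment that is dense on that side, and \<open>ts_floor y\<close>
  tends to \<open>x\<close> through points of the segment different from \<open>x\<close>, so the limit demanded by
  rd-continuity carries over.\<close>

lemma cadlag_extension:
  assumes "rd_continuous T a b f"
  shows "cadlag (\<lambda>x. f (ts_floor x))"
  unfolding cadlag_def
proof (intro allI conjI)
  fix x
  show "((\<lambda>x. f (ts_floor x)) \<longlongrightarrow> f (ts_floor x)) (at_right x)"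
  proof (cases "\<exists>e>0. ts_Icc T a b \<inter> {x<..<x+e} = {}")
    case True
    then obtain e where e: "0 < e" "ts_Icc T a b \<inter> {x<..<x+e} = {}" by blast
    have "f (ts_floor y) = f (ts_floor x)" if "x < y" "y < x + e" for y
      using ts_floor_eq[of x y] e(2) that by force
    then have "\<forall>\<^sub>F y in at_right x. f (ts_floor y) = f (ts_floor x)"
      using e(1) by (auto simp: eventually_at_right_field intro!: exI[of _ "x + e"])
    then show ?thesis by (rule tendsto_eventually)
  next
    case False
    then have acc: "\<exists>s \<in> ts_Icc T a b. x < s \<and> s < x + e" if "0 < e" for e
      using that by fastforce
    have x: "x \<in> ts_Icc T a b"
      by (rule accumulation_mem) (use acc in force)
    have lim: "(f \<longlongrightarrow> f x) (at x within (ts_Icc T a b \<inter> {x<..}))"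
      using assms right_dense_accumulation[OF acc] x by (auto simp: rd_continuous_def)
    have fl: "x < ts_floor y" "ts_floor y \<le> y" if "x < y" for y
    proof -
      obtain s where "s \<in> ts_Icc T a b" "x < s" "s < y" using acc[of "y - x"] \<open>x < y\<close> by auto
      then show "x < ts_floor y" using ts_floor_ge[of s y] by linarith
      show "ts_floor y \<le> y" using x \<open>x < y\<close> by (intro ts_floor_le) (auto simp: ts_Icc_def)
    qed
    have "(ts_floor \<longlongrightarrow> x) (at_right x)"
      by (rule tendsto_sandwich[of "\<lambda>_. x" _ _ "\<lambda>y. y"])
         (auto simp: eventually_at_right_field less_imp_le fl intro!: exI[of _ "x + 1"])
    then have "filterlim ts_floor (at x within (ts_Icc T a b \<inter> {x<..})) (at_right x)"
      using fl by (auto simp: filterlim_at ts_floor_mem eventually_at_right_field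
          intro!: exI[of _ "x + 1"])
    from filterlim_compose[OF lim this] show ?thesis by (simp add: ts_floor_id[OF x])
  qed
  show "\<exists>l. ((\<lambda>x. f (ts_floor x)) \<longlongrightarrow> l) (at_left x)"
  proof (cases "\<exists>e>0. ts_Icc T a b \<inter> {x-e<..<x} = {}")
    case True
    then obtain e where e: "0 < e" "ts_Icc T a b \<inter> {x-e<..<x} = {}" by blast
    have "f (ts_floor y) = f (ts_floor (x - e))" if "x - e < y" "y < x" for y
      using ts_floor_eq[of "x - e" y] e(2) that by force
    then have "\<forall>\<^sub>F y in at_left x. f (ts_floor y) = f (ts_floor (x - e))"
      using e(1) by (auto simp: eventually_at_left_field intro!: exI[of _ "x - e"])
    then show ?thesis by (blast intro: tendsto_eventually)
  next
    case False
    then have acc: "\<exists>s \<in> ts_Icc T a b. x - e < s \<and> s < x" if "0 < e" for e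
      using that by fastforce
    have x: "x \<in> ts_Icc T a b"
      by (rule accumulation_mem) (use acc in force)
    obtain l where lim: "(f \<longlongrightarrow> l) (at x within (ts_Icc T a b \<inter> {..<x}))"
      using assms left_dense_accumulation[OF acc] x by (auto simp: rd_continuous_def)
    have ax: "a < x" using acc[of 1] by (auto simp: ts_Icc_def)
    have fl: "ts_floor y < x" if "a < y" "y < x" for y
      using ts_floor_le[of y] that by linarith
    have "(ts_floor \<longlongrightarrow> x) (at_left x)"
    proof (rule order_tendstoI)
      fix c assume "c < x"
      then obtain s where "s \<in> ts_Icc T a b" "c < s" "s < x" using acc[of "x - c"] by auto
      then have "c < ts_floor y" if "s < y" for y
        using ts_floor_ge[of s y] that by linarith
      then show "\<forall>\<^sub>F y in at_left x. c < ts_floor y"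
        using \<open>s < x\<close> by (auto simp: eventually_at_left_field)
    next
      fix c assume "x < c"
      then have "ts_floor y < c" if "a < y" "y < x" for y using fl[OF that] by linarith
      then show "\<forall>\<^sub>F y in at_left x. ts_floor y < c"
        using ax by (auto simp: eventually_at_left_field)
    qed
    moreover have "\<forall>\<^sub>F y in at_left x. ts_floor y < x"
      using ax fl by (auto simp: eventually_at_left_field)
    ultimately have "filterlim ts_floor (at x within (ts_Icc T a b \<inter> {..<x})) (at_left x)"
      by (auto simp: filterlim_at ts_floor_mem elim: eventually_mono)
    from filterlim_compose[OF lim this] show ?thesis by blast
  qed
qed


section \<open>The filter of fine tagged divisions\<close>

definition delta_sums :: "(nat \<times> (nat \<Rightarrow> real) \<times> (nat \<Rightarrow> real)) filter" where
  "delta_sums = (INF \<delta>\<in>{0<..}. principal {(n, t, \<xi>). fine_division T a b \<delta> n t \<and>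
     (\<forall>i\<in>{1..n}. \<xi> i \<in> ts_Ico T (t (i - 1)) (t i))})"

lemma eventually_delta_sums:
  "eventually P delta_sums \<longleftrightarrow>
    (\<exists>\<delta>>0. \<forall>n t \<xi>. fine_division T a b \<delta> n t \<longrightarrow>
       (\<forall>i\<in>{1..n}. \<xi> i \<in> ts_Ico T (t (i - 1)) (t i)) \<longrightarrow> P (n, t, \<xi>))"
proof -
  have mono: "fine_division T a b d n t" if "fine_division T a b c n t" "c \<le> d" for c d n t
    using that unfolding fine_division_def by (meson le_less_linear order_trans)
  have base: "\<exists>x\<in>{0<..}. principal {(n, t, \<xi>). fine_division T a b x n t \<and>
         (\<forall>i\<in>{1..n}. \<xi> i \<in> ts_Ico T (t (i - 1)) (t i))}
       \<le> inf (principal {(n, t, \<xi>). fine_division T a b c n t \<and>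
         (\<forall>i\<in>{1..n}. \<xi> i \<in> ts_Ico T (t (i - 1)) (t i))})
         (principal {(n, t, \<xi>). fine_division T a b d n t \<and>
         (\<forall>i\<in>{1..n}. \<xi> i \<in> ts_Ico T (t (i - 1)) (t i))})"
    if "c \<in> {0<..}" "d \<in> {0<..}" for c d :: real
    using that by (intro bexI[of _ "min c d"]) (auto intro: mono)
  then show ?thesis
    unfolding delta_sums_def
    by (subst eventually_INF_base[OF _ base])
       (auto simp: eventually_principal Bex_def split_paired_All imp_conjL)
qed

text \<open>The form in which sums are compared term by term: the tags are points of the segment, where the
  functions are controlled, and the increments are positive, so that multiplying by them preserves
  inequalities.\<close>

lemma eventually_delta_sumsI:
  assumes "\<And>n t \<xi>. ts_division T a b n t \<Longrightarrow>
    (\<And>i. i \<in> {1..n} \<Longrightarrow> \<xi> i \<in> ts_Icc T a b \<and> t (i - 1) < t i) \<Longrightarrow> P (n, t, \<xi>)"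
  shows "eventually P delta_sums"
  unfolding eventually_delta_sums
proof (intro exI[of _ 1] conjI allI impI)
  fix n t \<xi>
  assume fine: "fine_division T a b 1 n t" and tags: "\<forall>i\<in>{1..n}. \<xi> i \<in> ts_Ico T (t (i - 1)) (t i)"
  show "P (n, t, \<xi>)"
  proof (rule assms)
    show div: "ts_division T a b n t" using fine by (simp add: fine_division_def)
    fix i assume i: "i \<in> {1..n}"
    then have "t (i - 1) \<in> ts_Icc T a b" "t i \<in> ts_Icc T a b"
      using div by (auto simp: ts_division_def)
    then show "\<xi> i \<in> ts_Icc T a b \<and> t (i - 1) < t i"
      using bspec[OF tags i] by (auto simp: ts_Icc_def ts_Ico_def)
  qed
qed simp

lemma division_extend:
  assumes "fine_division T a c \<delta> n t" "c < d" "d \<in> T" "d - c \<le> \<delta> \<or> ts_rho T d = c"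
  shows "fine_division T a d \<delta> (Suc n) (t(Suc n := d))"
proof -
  let ?t = "t(Suc n := d)"
  have t: "t 0 = a" "t n = c" "\<And>i. i \<in> {1..n} \<Longrightarrow> t (i - 1) < t i" "\<And>i. i \<le> n \<Longrightarrow> t i \<in> ts_Icc T a c"
    "\<And>i. i \<in> {1..n} \<Longrightarrow> t i - t (i - 1) \<le> \<delta> \<or> (t i - t (i - 1) > \<delta> \<and> ts_rho T (t i) = t (i - 1))"
    using assms(1) by (auto simp: fine_division_def ts_division_def)
  have "?t (i - 1) < ?t i \<and> (?t i - ?t (i - 1) \<le> \<delta> \<or>
          (?t i - ?t (i - 1) > \<delta> \<and> ts_rho T (?t i) = ?t (i - 1)))" if "i \<in> {1..Suc n}" for i
  proof (cases "i = Suc n")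
    case True
    then show ?thesis using t(2) assms(2,4) by auto
  next
    case False
    then have "i \<in> {1..n}" "?t i = t i" "?t (i - 1) = t (i - 1)" using that by auto
    then show ?thesis using t(3,5)[of i] by simp
  qed
  moreover have "?t i \<in> ts_Icc T a d" if "i \<le> Suc n" for i
    using that t(4)[of i] t(4)[of n] t(2) assms(2,3) by (cases "i = Suc n") (auto simp: ts_Icc_def)
  ultimately show ?thesis
    using t(1) unfolding fine_division_def ts_division_def by (metis fun_upd_apply nat.distinct(1))
qed

text \<open>Let \<open>s\<close> be the supremum of the points \<open>c\<close> of the segment such that \<open>{a..c}\<close> has a fine division.
  It is one of them, because a step of length at most \<open>\<delta>\<close> leads to it. If \<open>s < b\<close>, then no point of
  \<open>T\<close> lies in \<open>{s<..s + \<delta>}\<close>, so the next point of \<open>T\<close> exists, and the step across the gap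
  is allowed whatever its length, a contradiction.\<close>

lemma fine_division_exists:
  assumes "0 < \<delta>"
  shows "\<exists>n t. fine_division T a b \<delta> n t"
proof -
  define C where "C = {c \<in> ts_Icc T a b. \<exists>n t. fine_division T a c \<delta> n t}"
  have step: "d \<in> C" if "c \<in> C" "c < d" "d \<in> ts_Icc T a b" "d - c \<le> \<delta> \<or> ts_rho T d = c" for c d
    using that division_extend[of c \<delta> _ _ d] unfolding C_def ts_Icc_def by blast
  have "fine_division T a a \<delta> 0 (\<lambda>_. a)"
    using a_in by (simp add: fine_division_def ts_division_def ts_Icc_def)
  then have aC: "a \<in> C" using a_in a_le_b by (auto simp: C_def ts_Icc_def)
  have bdd: "bdd_above C" by (rule bdd_aboveI[of _ b]) (auto simp: C_def ts_Icc_def)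
  define s where "s = Sup C"
  have up: "c \<le> s" if "c \<in> C" for c unfolding s_def using that bdd by (rule cSup_upper)
  have app: "\<exists>c\<in>C. s - e < c" if "0 < e" for e
    using less_cSup_iff[OF _ bdd, of "s - e"] aC that unfolding s_def by auto
  have "s \<in> ts_Icc T a b"
  proof (rule accumulation_mem)
    fix e :: real assume "0 < e"
    then obtain c where "c \<in> C" "s - e < c" using app by blast
    then show "\<exists>c \<in> ts_Icc T a b. \<bar>c - s\<bar> < e"
      using up[of c] by (intro bexI[of _ c]) (auto simp: C_def)
  qed
  have sC: "s \<in> C"
  proof -
    obtain c where c: "c \<in> C" "s - \<delta> < c" using app assms by blast
    show ?thesis
    proof (cases "c = s")
      case False
      then show ?thesis using step[of c s] c up[of c] \<open>s \<in> ts_Icc T a b\<close> by auto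
    qed (use c in auto)
  qed
  have "s = b"
  proof (rule ccontr)
    assume "s \<noteq> b"
    then have sb: "s < b" using \<open>s \<in> ts_Icc T a b\<close> by (auto simp: ts_Icc_def)
    \<comment> \<open>The least point to the right of \<open>s\<close> is reached by jumping the gap after \<open>s\<close>.\<close>
    define R where "R = T \<inter> {s<..b}"
    have bR: "b \<in> R" using sb b_in by (auto simp: R_def)
    have no: "r \<notin> C" if "r \<in> R" for r using up[of r] that by (auto simp: R_def)
    have Rsub: "r \<in> ts_Icc T a b" "s < r" if "r \<in> R" for r
      using that \<open>s \<in> ts_Icc T a b\<close> by (auto simp: R_def ts_Icc_def)
    have far: "s + \<delta> < r" if "r \<in> R" for r
      using step[OF sC, of r] no[OF that] Rsub[OF that] by force
    have "R = T \<inter> {s + \<delta>..b}" using far assms by (force simp: R_def)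
    then have "closed R" using ts by (auto simp: time_scale_def)
    then have m: "Inf R \<in> R" using bR far
      by (intro closed_contains_Inf bdd_belowI[of _ "s + \<delta>"]) (auto intro: less_imp_le)
    have "Sup {u \<in> T. u < Inf R} = s"
    proof (rule cSup_eq_maximum)
      show "s \<in> {u \<in> T. u < Inf R}"
        using \<open>s \<in> ts_Icc T a b\<close> Rsub(2)[OF m] by (auto simp: ts_Icc_def)
      show "u \<le> s" if "u \<in> {u \<in> T. u < Inf R}" for u
      proof (rule ccontr)
        assume "\<not> u \<le> s"
        then have "u \<in> R" using that m by (auto simp: R_def)
        then have "Inf R \<le> u" using far
          by (intro cInf_lower bdd_belowI[of _ "s + \<delta>"]) (auto intro: less_imp_le)
        then show False using that by auto
      qed
    qed
    then have "ts_rho T (Inf R) = s"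
      using \<open>s \<in> ts_Icc T a b\<close> Rsub(2)[OF m] by (auto simp: ts_rho_def ts_Icc_def)
    then show False using step[OF sC, of "Inf R"] no[OF m] Rsub[OF m] by auto
  qed
  then show ?thesis using sC by (auto simp: C_def)
qed

text \<open>A fine division becomes a tagged one by taking left endpoints as tags.\<close>

lemma delta_sums_nontrivial: "delta_sums \<noteq> bot"
proof -
  have "\<not> eventually (\<lambda>_. False) delta_sums"
    unfolding eventually_delta_sums
  proof (clarsimp)
    fix \<delta> :: real assume "0 < \<delta>"
    then obtain n t where nt: "fine_division T a b \<delta> n t" using fine_division_exists by blast
    then have "\<forall>i\<in>{1..n}. t (i - 1) \<in> ts_Ico T (t (i - 1)) (t i)"
      by (auto simp: fine_division_def ts_division_def ts_Ico_def ts_Icc_def)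
    then show "\<exists>n t. fine_division T a b \<delta> n t \<and>
        (\<exists>\<xi>. \<forall>i\<in>{Suc 0..n}. \<xi> i \<in> ts_Ico T (t (i - Suc 0)) (t i))"
      using nt by (intro exI[of _ n] exI[of _ t] conjI exI[of _ "\<lambda>i. t (i - 1)"]) auto
  qed
  then show ?thesis by (simp add: trivial_limit_def)
qed


section \<open>Convergence of delta-sums\<close>

definition tag_sum :: "(real \<Rightarrow> real) \<Rightarrow> nat \<times> (nat \<Rightarrow> real) \<times> (nat \<Rightarrow> real) \<Rightarrow> real" where
  "tag_sum f = (\<lambda>(n, t, \<xi>). \<Sum>i\<in>{1..n}. (t i - t (i - 1)) * f (\<xi> i))"

lemma division_mono:
  assumes "ts_division T a b n t" "i \<le> j" "j \<le> n"
  shows "t i \<le> t j"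
  using assms(2,3)
proof (induction j rule: dec_induct)
  case (step m)
  have "t (Suc m - 1) < t (Suc m)"
    using bspec[of "{1..n}" "\<lambda>i. t (i - 1) < t i" "Suc m"] assms(1) step.prems
    by (simp add: ts_division_def)
  then show ?case using step by simp
qed simp

lemma division_sum_integral:
  fixes F :: "real \<Rightarrow> real"
  assumes "ts_division T a b n t" "F integrable_on {a..b}"
  shows "(\<Sum>i\<in>{1..n}. integral {t (i - 1)..t i} F) = integral {a..b} F"
proof -
  have t0: "t 0 = a" "t n = b" using assms(1) by (auto simp: ts_division_def)
  have "(\<Sum>i\<in>{1..k}. integral {t (i - 1)..t i} F) = integral {a..t k} F" if "k \<le> n" for k
    using that
  proof (induction k)
    case 0
    then show ?case by (simp add: t0)
  next
    case (Suc k)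
    have le: "a \<le> t k" "t k \<le> t (Suc k)" "t (Suc k) \<le> b"
      using division_mono[OF assms(1), of 0 k] division_mono[OF assms(1), of k "Suc k"]
        division_mono[OF assms(1), of "Suc k" n] Suc.prems by (auto simp: t0)
    have "F integrable_on {a..t (Suc k)}"
      using assms(2) by (rule integrable_on_subinterval) (use le in auto)
    from Henstock_Kurzweil_Integration.integral_combine[OF le(1,2) this] Suc show ?case
      by simp
  qed
  from this[of n] show ?thesis by (simp add: t0)
qed

text \<open>The open cells of a division are disjoint, so a cut point spoils at most one of them.\<close>

lemma division_card_cells:
  assumes "ts_division T a b n t"
  shows "card {i\<in>{1..n}. t (i - 1) < s \<and> s < t i} \<le> 1"
proof -
  have "i = j" if "i \<in> {1..n}" "t (i - 1) < s" "s < t i" "j \<in> {1..n}" "t (j - 1) < s" "s < t j" for i j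
  proof (rule ccontr)
    assume "i \<noteq> j"
    then consider "i \<le> j - 1" | "j \<le> i - 1" by linarith
    then show False
    proof cases
      case 1
      then have "t i \<le> t (j - 1)" using that by (intro division_mono[OF assms]) auto
      then show False using that by linarith
    next
      case 2
      then have "t j \<le> t (i - 1)" using that by (intro division_mono[OF assms]) auto
      then show False using that by linarith
    qed
  qed
  then show ?thesis by (subst card_le_Suc0_iff_eq[unfolded One_nat_def[symmetric]]) auto
qed

text \<open>Compare the sum with \<open>integral {a..b} F\<close> cell by cell, where \<open>F = f \<circ> ts_floor\<close>. A cell on which
  \<open>F\<close> varies by at most \<open>e\<close> has an error of at most \<open>e\<close> times its length; this covers the cells
  that span a gap of \<open>T\<close>, where \<open>F\<close> is constant. Every other cell has length at most \<open>\<delta>\<close> and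
  contains a cut point; its error is at most \<open>2 * M * \<delta>\<close>, and there are at most \<open>card S\<close> such cells.\<close>

lemma tag_sum_tendsto:
  assumes "rd_continuous T a b f"
  shows "(tag_sum f \<longlongrightarrow> integral {a..b} (\<lambda>x. f (ts_floor x))) delta_sums"
proof -
  define F where "F = (\<lambda>x. f (ts_floor x))"
  have F: "cadlag F" unfolding F_def using assms by (rule cadlag_extension)
  have int: "F integrable_on {a..b}" using F a_le_b by (rule cadlag_integrable)
  obtain M where M: "0 \<le> M" "\<And>x. x \<in> {a..b} \<Longrightarrow> \<bar>F x\<bar> \<le> M"
    using cadlag_bounded[OF F a_le_b] by blast
  have "(tag_sum f \<longlongrightarrow> integral {a..b} F) delta_sums"
  proof (rule tendstoI)
    fix \<epsilon> :: real assume "0 < \<epsilon>"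
    define e where "e = \<epsilon> / (2 * (b - a + 1))"
    have e: "0 < e" "e * (b - a) < \<epsilon> / 2"
      using a_le_b \<open>0 < \<epsilon>\<close> by (auto simp: e_def field_simps)
    obtain S where S: "finite S"
      "\<And>u v z w. a \<le> u \<Longrightarrow> v \<le> b \<Longrightarrow> {u<..<v} \<inter> S = {} \<Longrightarrow> z \<in> {u..<v} \<Longrightarrow> w \<in> {u..<v}
         \<Longrightarrow> \<bar>F z - F w\<bar> \<le> e"
      using cadlag_small_oscillation[OF F a_le_b e(1)] by blast
    \<comment> \<open>The summand \<open>1\<close> keeps \<open>K\<close> positive and makes the estimate for \<open>\<delta>\<close> strict.\<close>
    define K where "K = 2 * M * card S + 1"
    have K: "0 < K" using M(1) by (auto simp: K_def intro: add_nonneg_pos)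
    define \<delta> where "\<delta> = \<epsilon> / (2 * K)"
    have \<delta>: "0 < \<delta>" "2 * M * \<delta> * card S < \<epsilon> / 2"
    proof -
      show "0 < \<delta>" using \<open>0 < \<epsilon>\<close> K by (simp add: \<delta>_def)
      then have "(K - 1) * \<delta> < K * \<delta>" by (simp add: algebra_simps)
      also have "K * \<delta> = \<epsilon> / 2" using K by (simp add: \<delta>_def)
      finally show "2 * M * \<delta> * card S < \<epsilon> / 2" by (simp add: K_def mult_ac)
    qed
    show "\<forall>\<^sub>F D in delta_sums. dist (tag_sum f D) (integral {a..b} F) < \<epsilon>"
      unfolding eventually_delta_sums
    proof (intro exI[of _ \<delta>] conjI allI impI \<delta>(1))
      fix n t \<xi>
      assume fine: "fine_division T a b \<delta> n t"
        and tags: "\<forall>i\<in>{1..n}. \<xi> i \<in> ts_Ico T (t (i - 1)) (t i)"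
      have div: "ts_division T a b n t" using fine by (simp add: fine_division_def)
      define cell where "cell s = {i\<in>{1..n}. t (i - 1) < s \<and> s < t i}" for s
      define err where "err i = (t i - t (i - 1)) * f (\<xi> i) - integral {t (i - 1)..t i} F" for i
      \<comment> \<open>The inner sum charges \<open>2 * M * \<delta>\<close> to the cell for each cut point inside it, which allows the
        charges to be counted by cut points after exchanging the sums.\<close>
      have err: "\<bar>err i\<bar> \<le> e * (t i - t (i - 1)) + (\<Sum>s\<in>S. if i \<in> cell s then 2 * M * \<delta> else 0)"
        if i: "i \<in> {1..n}" for i
      proof -
        let ?u = "t (i - 1)" and ?v = "t i"
        have uv: "?u < ?v" "?u \<in> ts_Icc T a b" "?v \<in> ts_Icc T a b"
          using div i by (auto simp: ts_division_def)
        have ab: "a \<le> ?u" "?v \<le> b" using uv by (auto simp: ts_Icc_def)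
        have tag: "\<xi> i \<in> {?u..<?v}" "\<xi> i \<in> ts_Icc T a b"
          using bspec[OF tags i] ab by (auto simp: ts_Ico_def ts_Icc_def)
        have f\<xi>: "f (\<xi> i) = F (\<xi> i)" using tag by (simp add: F_def ts_floor_id)
        have intuv: "F integrable_on {?u..?v}"
          using int by (rule integrable_on_subinterval) (use ab in auto)
        have nonneg: "0 \<le> (\<Sum>s\<in>S. if i \<in> cell s then 2 * M * \<delta> else 0)"
          using M(1) \<delta>(1) by (intro sum_nonneg) auto
        have small: ?thesis if "\<And>w. w \<in> {?u..<?v} \<Longrightarrow> \<bar>F w - F (\<xi> i)\<bar> \<le> e"
          using integral_minus_tag_bound[OF intuv _ _ that] uv(1) e(1) nonneg
          unfolding err_def f\<xi> by force
        show ?thesis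
        proof (cases "{?u<..<?v} \<inter> S = {}")
          case True
          then show ?thesis using S(2)[OF ab True _ tag(1)] by (intro small) auto
        next
          case False
          then obtain s where s: "s \<in> S" "?u < s" "s < ?v" by auto
          then have cell: "i \<in> cell s" using i by (simp add: cell_def)
          consider "?v - ?u \<le> \<delta>" | "ts_rho T ?v = ?u"
            using fine i unfolding fine_division_def by blast
          then show ?thesis
          proof cases
            case 1
            have "\<bar>err i\<bar> \<le> 2 * M * (?v - ?u)"
              unfolding err_def f\<xi>
            proof (rule integral_minus_tag_bound[OF intuv])
              fix w assume "w \<in> {?u..<?v}"
              then show "\<bar>F w - F (\<xi> i)\<bar> \<le> 2 * M"
                using M(2)[of w] M(2)[of "\<xi> i"] tag ab by auto
            qed (use uv M in auto)
            also have "\<dots> \<le> 2 * M * \<delta>" using 1 M(1) by (intro mult_left_mono) auto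
            also have "\<dots> \<le> (\<Sum>s\<in>S. if i \<in> cell s then 2 * M * \<delta> else 0)"
              using member_le_sum[OF s(1), of "\<lambda>s. if i \<in> cell s then 2 * M * \<delta> else 0"]
                cell S(1) M(1) \<delta>(1) by auto
            also have "\<dots> \<le> e * (?v - ?u) + \<dots>" using e(1) uv(1) by auto
            finally show ?thesis .
          next
            case 2
            have gap: "r \<le> ?u" if "r \<in> T" "r < ?v" for r
            proof -
              have "r \<le> Sup {s \<in> T. s < ?v}"
                using that by (intro cSup_upper bdd_aboveI[of _ ?v]) auto
              then show ?thesis using 2 that by (auto simp: ts_rho_def split: if_splits)
            qed
            have "ts_floor w = ?u" if "w \<in> {?u..<?v}" for w
              using that uv gap by (intro ts_floor_eqI) (force simp: ts_Icc_def)+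
            then show ?thesis using tag e(1) by (intro small) (auto simp: F_def)
          qed
        qed
      qed
      have "tag_sum f (n, t, \<xi>) - integral {a..b} F = (\<Sum>i\<in>{1..n}. err i)"
        unfolding division_sum_integral[OF div int, symmetric]
        by (simp add: tag_sum_def err_def sum_subtractf)
      also have "\<bar>\<dots>\<bar> \<le> (\<Sum>i\<in>{1..n}. \<bar>err i\<bar>)" by (rule sum_abs)
      also have "\<dots> \<le> (\<Sum>i\<in>{1..n}. e * (t i - t (i - 1)) +
                         (\<Sum>s\<in>S. if i \<in> cell s then 2 * M * \<delta> else 0))"
        using err by (rule sum_mono)
      also have "\<dots> = e * (b - a) + (\<Sum>s\<in>S. \<Sum>i\<in>{1..n}. if i \<in> cell s then 2 * M * \<delta> else 0)"
      proof -
        have "(\<Sum>i\<in>{1..n}. t i - t (i - 1)) = (\<Sum>i\<in>{1..n}. integral {t (i - 1)..t i} (\<lambda>_. 1))"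
        proof (rule sum.cong)
          fix i assume "i \<in> {1..n}"
          then have "t (i - 1) \<le> t i" by (intro division_mono[OF div]) auto
          then show "t i - t (i - 1) = integral {t (i - 1)..t i} (\<lambda>_. 1)" by simp
        qed simp
        also have "\<dots> = b - a"
          by (subst division_sum_integral[OF div]) (use a_le_b in auto)
        finally have len: "(\<Sum>i\<in>{1..n}. t i - t (i - 1)) = b - a" .
        have "(\<Sum>i\<in>{1..n}. e * (t i - t (i - 1))) = e * (b - a)"
          unfolding sum_distrib_left[symmetric] len ..
        moreover have "(\<Sum>i\<in>{1..n}. \<Sum>s\<in>S. if i \<in> cell s then 2 * M * \<delta> else 0) =
            (\<Sum>s\<in>S. \<Sum>i\<in>{1..n}. if i \<in> cell s then 2 * M * \<delta> else 0)"
          by (rule sum.swap)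
        ultimately show ?thesis by (simp only: sum.distrib)
      qed
      also have "(\<Sum>s\<in>S. \<Sum>i\<in>{1..n}. if i \<in> cell s then 2 * M * \<delta> else 0) \<le> (\<Sum>s\<in>S. 2 * M * \<delta>)"
      proof (rule sum_mono)
        fix s
        have "(\<Sum>i\<in>{1..n}. if i \<in> cell s then 2 * M * \<delta> else 0) = card (cell s) * (2 * M * \<delta>)"
        proof -
          have "{1..n} \<inter> {i. i \<in> cell s} = cell s" by (auto simp: cell_def)
          then show ?thesis by (simp add: sum.If_cases)
        qed
        also have "\<dots> \<le> 1 * (2 * M * \<delta>)"
          using division_card_cells[OF div, of s] M(1) \<delta>(1)
          by (intro mult_right_mono) (auto simp: cell_def)
        finally show "(\<Sum>i\<in>{1..n}. if i \<in> cell s then 2 * M * \<delta> else 0) \<le> 2 * M * \<delta>" by simp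
      qed
      also have "(\<Sum>s\<in>S. 2 * M * \<delta>) = 2 * M * \<delta> * card S" by simp
      finally show "dist (tag_sum f (n, t, \<xi>)) (integral {a..b} F) < \<epsilon>"
        using e(2) \<delta>(2) by (simp add: dist_real_def)
    qed
  qed
  then show ?thesis by (simp add: F_def)
qed

lemma tag_sum_limit_mono:
  assumes "\<And>s. s \<in> ts_Icc T a b \<Longrightarrow> f s \<le> g s"
    and "(tag_sum f \<longlongrightarrow> A) delta_sums" "(tag_sum g \<longlongrightarrow> B) delta_sums"
  shows "A \<le> B"
proof (rule tendsto_le[OF delta_sums_nontrivial assms(3,2)], rule eventually_delta_sumsI)
  fix n :: nat and t \<xi> :: "nat \<Rightarrow> real"
  assume "\<And>i. i \<in> {1..n} \<Longrightarrow> \<xi> i \<in> ts_Icc T a b \<and> t (i - 1) < t i"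
  then show "tag_sum f (n, t, \<xi>) \<le> tag_sum g (n, t, \<xi>)"
    unfolding tag_sum_def prod.case by (intro sum_mono mult_left_mono assms(1)) (auto simp: less_imp_le)
qed

lemma tag_sum_limit_cong:
  assumes "\<And>s. s \<in> ts_Icc T a b \<Longrightarrow> f s = g s"
  shows "(tag_sum f \<longlongrightarrow> A) delta_sums \<longleftrightarrow> (tag_sum g \<longlongrightarrow> A) delta_sums"
  by (intro tendsto_cong eventually_delta_sumsI) (auto simp: tag_sum_def assms intro!: sum.cong)

end


section \<open>Endpoints of interval-valued functions\<close>

lemma lower_sum_interval: "lower (\<Sum>i\<in>I. X i) = (\<Sum>i\<in>I. lower (X i :: real interval))"
  by (induction I rule: infinite_finite_induct) auto

lemma upper_sum_interval: "upper (\<Sum>i\<in>I. X i) = (\<Sum>i\<in>I. upper (X i :: real interval))"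
  by (induction I rule: infinite_finite_induct) auto

lemma lower_upper_times_nonneg:
  fixes X Y :: "real interval"
  assumes "0 \<le> lower X" "0 \<le> lower Y"
  shows "lower (X * Y) = lower X * lower Y" "upper (X * Y) = upper X * upper Y"
proof -
  have "0 \<le> upper X" "0 \<le> upper Y"
    using assms lower_le_upper[of X] lower_le_upper[of Y] by linarith+
  then have "lower X * lower Y \<le> lower X * upper Y" "lower X * lower Y \<le> upper X * lower Y"
    "lower X * lower Y \<le> upper X * upper Y" "lower X * upper Y \<le> upper X * upper Y"
    "upper X * lower Y \<le> upper X * upper Y"
    using assms by (auto intro!: mult_mono)
  then show "lower (X * Y) = lower X * lower Y" "upper (X * Y) = upper X * upper Y"
    by (auto simp: lower_times upper_times)
qed

lemma rd_continuous_cong: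
  assumes "\<And>t. t \<in> ts_Icc T a b \<Longrightarrow> f t = g t"
  shows "rd_continuous T a b f \<longleftrightarrow> rd_continuous T a b g"
proof -
  have "(f \<longlongrightarrow> l) (at t within (ts_Icc T a b \<inter> R)) \<longleftrightarrow> (g \<longlongrightarrow> l) (at t within (ts_Icc T a b \<inter> R))"
    for t l R
    by (rule tendsto_cong) (auto simp: eventually_at_topological assms)
  then show ?thesis by (simp add: rd_continuous_def assms)
qed

lemma rd_continuous_mult:
  assumes "rd_continuous T a b f" "rd_continuous T a b g"
  shows "rd_continuous T a b (\<lambda>t. f t * g t)"
  using assms unfolding rd_continuous_def by (blast intro: tendsto_mult)

text \<open>A left limit of the positive function \<open>f\<close> can be \<open>0\<close>; there the continuity of the power at \<open>0\<close>
  within the nonnegative numbers is needed, hence the condition \<open>0 < r\<close>.\<close>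

lemma rd_continuous_powr:
  assumes "rd_continuous T a b f" "0 < r" "\<And>t. t \<in> ts_Icc T a b \<Longrightarrow> 0 < f t"
  shows "rd_continuous T a b (\<lambda>t. f t powr r)"
proof -
  have lim: "((\<lambda>t. f t powr r) \<longlongrightarrow> l powr r) (at t within (ts_Icc T a b \<inter> R))"
    if "(f \<longlongrightarrow> l) (at t within (ts_Icc T a b \<inter> R))" for t l R
  proof (rule tendsto_powr'[OF that tendsto_const])
    have "\<forall>\<^sub>F x in at t within (ts_Icc T a b \<inter> R). 0 \<le> f x"
      by (auto simp: eventually_at_topological less_imp_le[OF assms(3)])
    then show "l \<noteq> 0 \<or> 0 < r \<and> (\<forall>\<^sub>F x in at t within (ts_Icc T a b \<inter> R). 0 \<le> f x)"
      using assms(2) by blast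
  qed
  show ?thesis
    using assms(1) unfolding rd_continuous_def by (blast intro: lim)
qed

lemma C_rd_ivl_positiveI:
  assumes "\<And>t. t \<in> ts_Icc T a b \<Longrightarrow> lower (F t) = l t" "\<And>t. t \<in> ts_Icc T a b \<Longrightarrow> upper (F t) = u t"
    and "\<And>t. t \<in> ts_Icc T a b \<Longrightarrow> 0 < l t"
    and "rd_continuous T a b l" "rd_continuous T a b u"
  shows "F \<in> C_rd_ivl T a b positive_ivls"
  using assms rd_continuous_cong[of T a b "\<lambda>t. lower (F t)" l]
    rd_continuous_cong[of T a b "\<lambda>t. upper (F t)" u]
  by (auto simp: C_rd_ivl_def positive_ivls_def)

lemma C_rd_ivl_positiveD:
  assumes "F \<in> C_rd_ivl T a b positive_ivls"
  shows "rd_continuous T a b (\<lambda>t. lower (F t))" "rd_continuous T a b (\<lambda>t. upper (F t))"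
    "\<And>t. t \<in> ts_Icc T a b \<Longrightarrow> 0 < lower (F t)" "\<And>t. t \<in> ts_Icc T a b \<Longrightarrow> 0 < upper (F t)"
proof -
  show low: "0 < lower (F t)" if "t \<in> ts_Icc T a b" for t
    using assms that by (auto simp: C_rd_ivl_def positive_ivls_def)
  show "0 < upper (F t)" if "t \<in> ts_Icc T a b" for t
    using low[OF that] lower_le_upper[of "F t"] by linarith
qed (use assms in \<open>auto simp: C_rd_ivl_def\<close>)

lemma C_rd_ivl_times:
  assumes F: "F \<in> C_rd_ivl T a b positive_ivls" and G: "G \<in> C_rd_ivl T a b positive_ivls"
  shows "(\<lambda>s. F s * G s) \<in> C_rd_ivl T a b positive_ivls"
proof (rule C_rd_ivl_positiveI)
  show "rd_continuous T a b (\<lambda>s. lower (F s) * lower (G s))"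
    "rd_continuous T a b (\<lambda>s. upper (F s) * upper (G s))"
    by (intro rd_continuous_mult C_rd_ivl_positiveD[OF F] C_rd_ivl_positiveD[OF G])+
qed (use C_rd_ivl_positiveD(3)[OF F] C_rd_ivl_positiveD(3)[OF G] in
      \<open>auto simp: lower_upper_times_nonneg less_imp_le\<close>)

lemma C_rd_ivl_powr:
  assumes F: "F \<in> C_rd_ivl T a b positive_ivls" and "0 < r"
  shows "(\<lambda>s. F s powr\<^sub>I r) \<in> C_rd_ivl T a b positive_ivls"
proof (rule C_rd_ivl_positiveI)
  show "rd_continuous T a b (\<lambda>s. lower (F s) powr r)" "rd_continuous T a b (\<lambda>s. upper (F s) powr r)"
    by (intro rd_continuous_powr C_rd_ivl_positiveD[OF F] assms(2); assumption)+
  show "0 < lower (F s) powr r" if "s \<in> ts_Icc T a b" for s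
    using C_rd_ivl_positiveD(3)[OF F that] by simp
qed (use C_rd_ivl_positiveD(3)[OF F] assms(2) in \<open>auto simp: less_imp_le\<close>)

lemma C_rd_ivl_scale:
  assumes h: "h \<in> C_rd T a b {0<..}" and F: "F \<in> C_rd_ivl T a b positive_ivls"
  shows "(\<lambda>s. h s *\<^sub>I F s) \<in> C_rd_ivl T a b positive_ivls"
proof (rule C_rd_ivl_positiveI)
  have "rd_continuous T a b h" using h by (simp add: C_rd_def)
  then show "rd_continuous T a b (\<lambda>s. h s * lower (F s))" "rd_continuous T a b (\<lambda>s. h s * upper (F s))"
    by (intro rd_continuous_mult C_rd_ivl_positiveD[OF F]; assumption)+
qed (use C_rd_ivl_positiveD(3)[OF F] h in \<open>auto simp: C_rd_def less_imp_le\<close>)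


section \<open>The interval-valued integral through its endpoints\<close>

context ts_segment begin

text \<open>The distance of intervals is the maximum of the distances of their endpoints, and the endpoints of
  an interval-valued delta-sum are the delta-sums of the endpoints, since all increments are positive.\<close>

lemma has_IR_integral_iff:
  "has_IR_integral T a b F A \<longleftrightarrow>
    (tag_sum (\<lambda>s. lower (F s)) \<longlongrightarrow> lower A) delta_sums \<and>
    (tag_sum (\<lambda>s. upper (F s)) \<longlongrightarrow> upper A) delta_sums"
proof -
  have ends: "\<forall>\<^sub>F D in delta_sums. lower ((\<lambda>(n, t, \<xi>). delta_sum F n t \<xi>) D) = tag_sum (\<lambda>s. lower (F s)) D
      \<and> upper ((\<lambda>(n, t, \<xi>). delta_sum F n t \<xi>) D) = tag_sum (\<lambda>s. upper (F s)) D"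
    by (rule eventually_delta_sumsI)
       (auto simp: delta_sum_def tag_sum_def lower_sum_interval upper_sum_interval less_imp_le
         intro!: sum.cong)
  have "has_IR_integral T a b F A \<longleftrightarrow>
      (\<forall>\<epsilon>>0. \<forall>\<^sub>F D in delta_sums. ivl_dist ((\<lambda>(n, t, \<xi>). delta_sum F n t \<xi>) D) A < \<epsilon>)"
    by (simp add: has_IR_integral_def eventually_delta_sums)
  also have "\<dots> \<longleftrightarrow> (\<forall>\<epsilon>>0. (\<forall>\<^sub>F D in delta_sums. dist (tag_sum (\<lambda>s. lower (F s)) D) (lower A) < \<epsilon>) \<and>
      (\<forall>\<^sub>F D in delta_sums. dist (tag_sum (\<lambda>s. upper (F s)) D) (upper A) < \<epsilon>))"
    unfolding eventually_conj_iff[symmetric]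
    by (intro all_cong1 imp_cong refl eventually_cong[OF ends])
       (auto simp: ivl_dist_def dist_real_def)
  finally show ?thesis by (auto simp: tendsto_iff)
qed

lemma has_IR_integral_unique:
  assumes "has_IR_integral T a b F A" "has_IR_integral T a b F B"
  shows "A = B"
  using assms unfolding has_IR_integral_iff
  by (auto simp: interval_eq_iff intro: tendsto_unique[OF delta_sums_nontrivial])

lemma IR_integral_eq: "has_IR_integral T a b F A \<Longrightarrow> IR_integral T a b F = A"
  unfolding IR_integral_def by (blast intro: has_IR_integral_unique)

text \<open>The limits of the endpoint sums are ordered, because the endpoint functions are; hence they are
  the endpoints of an interval.\<close>

lemma rd_continuous_IR_integrable:
  assumes "F \<in> C_rd_ivl T a b X"
  shows "IR_integrable T a b F"
proof -
  define L where "L = integral {a..b} (\<lambda>x. lower (F (ts_floor x)))"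
  define U where "U = integral {a..b} (\<lambda>x. upper (F (ts_floor x)))"
  have L: "(tag_sum (\<lambda>s. lower (F s)) \<longlongrightarrow> L) delta_sums"
    and U: "(tag_sum (\<lambda>s. upper (F s)) \<longlongrightarrow> U) delta_sums"
    using assms by (auto simp: L_def U_def C_rd_ivl_def intro: tag_sum_tendsto)
  have "L \<le> U" by (rule tag_sum_limit_mono[OF _ L U]) simp
  then have "has_IR_integral T a b F (Interval (L, U))"
    using L U by (simp add: has_IR_integral_iff lower_upper_Interval)
  then show ?thesis by (auto simp: IR_integrable_def)
qed

lemma IR_integral_tendsto:
  assumes "IR_integrable T a b F"
  shows "(tag_sum (\<lambda>s. lower (F s)) \<longlongrightarrow> lower (IR_integral T a b F)) delta_sums"
    "(tag_sum (\<lambda>s. upper (F s)) \<longlongrightarrow> upper (IR_integral T a b F)) delta_sums"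
  using assms IR_integral_eq has_IR_integral_iff unfolding IR_integrable_def by metis+

lemma IR_integral_lower_nonneg:
  assumes "IR_integrable T a b F" "\<And>s. s \<in> ts_Icc T a b \<Longrightarrow> 0 \<le> lower (F s)"
  shows "0 \<le> lower (IR_integral T a b F)"
proof (rule tag_sum_limit_mono[OF _ _ IR_integral_tendsto(1)[OF assms(1)]])
  show "(tag_sum (\<lambda>_. 0) \<longlongrightarrow> 0) delta_sums"
    by (rule tendsto_eventually) (simp add: tag_sum_def split_beta)
qed (rule assms(2))

end


section \<open>Hoelder's inequality\<close>

text \<open>The usual argument: Young's inequality for \<open>u i / \<alpha>\<close> and \<open>v i / \<beta>\<close>, where \<open>\<alpha>\<close> and \<open>\<beta>\<close> are the two
  factors on the right, summed with the weights \<open>w i\<close>, gives \<open>1 / p + 1 / q = 1\<close>. If one factor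
  vanishes, so does every term on the left.\<close>

lemma Holder_inequality_sum:
  fixes w u v :: "'i \<Rightarrow> real"
  assumes "finite I" "p > 1" "1 / p + 1 / q = 1"
    and nonneg: "\<And>i. i \<in> I \<Longrightarrow> 0 \<le> w i" "\<And>i. i \<in> I \<Longrightarrow> 0 \<le> u i" "\<And>i. i \<in> I \<Longrightarrow> 0 \<le> v i"
  shows "(\<Sum>i\<in>I. w i * (u i * v i)) \<le>
    (\<Sum>i\<in>I. w i * u i powr p) powr (1 / p) * (\<Sum>i\<in>I. w i * v i powr q) powr (1 / q)"
proof -
  define A where "A = (\<Sum>i\<in>I. w i * u i powr p)"
  define B where "B = (\<Sum>i\<in>I. w i * v i powr q)"
  have q: "q > 1"
  proof -
    have "1 / q = 1 - 1 / p" using assms(3) by simp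
    then have "0 < 1 / q" "1 / q < 1" using assms(2) by auto
    then show ?thesis using zero_less_divide_1_iff[of q] by (simp add: field_simps)
  qed
  have AB: "0 \<le> A" "0 \<le> B"
    unfolding A_def B_def using nonneg by (auto intro!: sum_nonneg)
  show ?thesis
  proof (cases "A = 0 \<or> B = 0")
    case True
    have "w i * (u i * v i) = 0" if "i \<in> I" for i
      using True
    proof
      assume "A = 0"
      then have "w i * u i powr p = 0"
        using sum_nonneg_eq_0_iff[OF assms(1), of "\<lambda>i. w i * u i powr p"] nonneg that
        by (auto simp: A_def)
      then show ?thesis by auto
    next
      assume "B = 0"
      then have "w i * v i powr q = 0"
        using sum_nonneg_eq_0_iff[OF assms(1), of "\<lambda>i. w i * v i powr q"] nonneg that
        by (auto simp: B_def)
      then show ?thesis by auto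
    qed
    then have "(\<Sum>i\<in>I. w i * (u i * v i)) = 0" by (intro sum.neutral) blast
    then show ?thesis by simp
  next
    case False
    define \<alpha> where "\<alpha> = A powr (1 / p)"
    define \<beta> where "\<beta> = B powr (1 / q)"
    have pos: "0 < A" "0 < B" "0 < \<alpha>" "0 < \<beta>" using False AB by (auto simp: \<alpha>_def \<beta>_def)
    have pw: "\<alpha> powr p = A" "\<beta> powr q = B"
      using assms(2) q pos(1,2) by (auto simp: \<alpha>_def \<beta>_def powr_powr)
    have "w i * (u i * v i) / (\<alpha> * \<beta>) \<le> w i * u i powr p / A / p + w i * v i powr q / B / q"
      if "i \<in> I" for i
    proof -
      have "u i / \<alpha> * (v i / \<beta>) \<le> (u i / \<alpha>) powr p / p + (v i / \<beta>) powr q / q"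
        using assms(2,3) q nonneg(2,3)[OF that] pos by (intro Youngs_inequality) auto
      also have "\<dots> = u i powr p / A / p + v i powr q / B / q"
        using nonneg(2,3)[OF that] pos by (simp add: powr_divide pw)
      finally show ?thesis
        using mult_left_mono[OF _ nonneg(1)[OF that]] by (force simp: algebra_simps)
    qed
    then have "(\<Sum>i\<in>I. w i * (u i * v i) / (\<alpha> * \<beta>)) \<le>
        (\<Sum>i\<in>I. w i * u i powr p / A / p + w i * v i powr q / B / q)"
      by (rule sum_mono)
    also have "\<dots> = A / A / p + B / B / q"
      unfolding sum.distrib sum_divide_distrib[symmetric] A_def[symmetric] B_def[symmetric] ..
    also have "\<dots> = 1" using pos assms(3) by simp
    finally have "(\<Sum>i\<in>I. w i * (u i * v i)) / (\<alpha> * \<beta>) \<le> 1"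
      by (simp only: sum_divide_distrib)
    then have "(\<Sum>i\<in>I. w i * (u i * v i)) \<le> \<alpha> * \<beta>" using pos by (simp add: field_simps)
    then show ?thesis by (simp add: \<alpha>_def \<beta>_def A_def B_def)
  qed
qed

context ts_segment begin

text \<open>Hoelder's inequality holds for each delta-sum, with the increments absorbed into the weights.
  Both exponents \<open>1 / p\<close> and \<open>1 / q\<close> are positive, so the right-hand side is continuous
  on the nonnegative numbers even where a limit \<open>A\<close> or \<open>B\<close> is \<open>0\<close>.\<close>

lemma tag_sum_limit_Holder:
  assumes "p > 1" "1 / p + 1 / q = 1"
    and nonneg: "\<And>s. s \<in> ts_Icc T a b \<Longrightarrow> 0 \<le> h s \<and> 0 \<le> u s \<and> 0 \<le> v s"
    and C: "(tag_sum (\<lambda>s. h s * (u s * v s)) \<longlongrightarrow> C) delta_sums"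
    and A: "(tag_sum (\<lambda>s. h s * u s powr p) \<longlongrightarrow> A) delta_sums"
    and B: "(tag_sum (\<lambda>s. h s * v s powr q) \<longlongrightarrow> B) delta_sums"
  shows "C \<le> A powr (1 / p) * B powr (1 / q)"
proof (rule tendsto_le[OF delta_sums_nontrivial _ C])
  have "1 / p < 1" using assms(1) by simp
  then have "0 < 1 / q" using assms(2) by linarith
  have ev: "\<forall>\<^sub>F D in delta_sums. 0 \<le> tag_sum (\<lambda>s. h s * k s powr r) D" for k :: "real \<Rightarrow> real" and r
    by (rule eventually_delta_sumsI)
       (auto simp: tag_sum_def nonneg less_imp_le intro!: sum_nonneg mult_nonneg_nonneg)
  show "((\<lambda>D. tag_sum (\<lambda>s. h s * u s powr p) D powr (1 / p) * tag_sum (\<lambda>s. h s * v s powr q) D powr (1 / q))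
      \<longlongrightarrow> A powr (1 / p) * B powr (1 / q)) delta_sums"
    using assms(1) \<open>0 < 1 / q\<close> ev
    by (intro tendsto_mult tendsto_powr'[OF A tendsto_const] tendsto_powr'[OF B tendsto_const]) auto
  show "\<forall>\<^sub>F D in delta_sums. tag_sum (\<lambda>s. h s * (u s * v s)) D \<le>
      tag_sum (\<lambda>s. h s * u s powr p) D powr (1 / p) * tag_sum (\<lambda>s. h s * v s powr q) D powr (1 / q)"
  proof (rule eventually_delta_sumsI)
    fix n :: nat and t \<xi> :: "nat \<Rightarrow> real"
    assume tags: "\<And>i. i \<in> {1..n} \<Longrightarrow> \<xi> i \<in> ts_Icc T a b \<and> t (i - 1) < t i"
    have "(\<Sum>i\<in>{1..n}. ((t i - t (i - 1)) * h (\<xi> i)) * (u (\<xi> i) * v (\<xi> i))) \<le>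
      (\<Sum>i\<in>{1..n}. ((t i - t (i - 1)) * h (\<xi> i)) * u (\<xi> i) powr p) powr (1 / p) *
      (\<Sum>i\<in>{1..n}. ((t i - t (i - 1)) * h (\<xi> i)) * v (\<xi> i) powr q) powr (1 / q)"
      using assms(1,2) tags nonneg
      by (intro Holder_inequality_sum) (auto simp: less_imp_le intro!: mult_nonneg_nonneg)
    then show "tag_sum (\<lambda>s. h s * (u s * v s)) (n, t, \<xi>) \<le>
      tag_sum (\<lambda>s. h s * u s powr p) (n, t, \<xi>) powr (1 / p) *
      tag_sum (\<lambda>s. h s * v s powr q) (n, t, \<xi>) powr (1 / q)"
      by (simp only: tag_sum_def prod.case mult.assoc)
  qed
qed

end

theorem theorem13:
  fixes T :: "real set" and a b p q :: real
    and h :: "real \<Rightarrow> real" and f g :: "real \<Rightarrow> real interval"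
  assumes "time_scale T" and "a \<in> T" and "b \<in> T" and "a < b"
    and "h \<in> C_rd T a b {0<..}"
    and "f \<in> C_rd_ivl T a b positive_ivls"
    and "g \<in> C_rd_ivl T a b positive_ivls"
    and "1 / p + 1 / q = 1" and "p > 1"
  shows "IR_integrable T a b (\<lambda>s. h s *\<^sub>I (f s * g s)) \<and>
         IR_integrable T a b (\<lambda>s. h s *\<^sub>I (f s powr\<^sub>I p)) \<and>
         IR_integrable T a b (\<lambda>s. h s *\<^sub>I (g s powr\<^sub>I q)) \<and>
         IR_integral T a b (\<lambda>s. h s *\<^sub>I (f s * g s)) \<le>\<^sub>I
           (IR_integral T a b (\<lambda>s. h s *\<^sub>I (f s powr\<^sub>I p))) powr\<^sub>I (1 / p) *
           (IR_integral T a b (\<lambda>s. h s *\<^sub>I (g s powr\<^sub>I q))) powr\<^sub>I (1 / q)"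
proof -
  interpret ts_segment T a b using assms(1-4) by unfold_locales auto
  let ?FG = "\<lambda>s. h s *\<^sub>I (f s * g s)"
  let ?F = "\<lambda>s. h s *\<^sub>I (f s powr\<^sub>I p)"
  let ?G = "\<lambda>s. h s *\<^sub>I (g s powr\<^sub>I q)"
  have "1 / p < 1" using assms(9) by simp
  then have iq: "0 < 1 / q" using assms(8) by linarith
  then have q: "0 < q" by simp
  have p: "0 < p" using assms(9) by simp
  have F: "?F \<in> C_rd_ivl T a b positive_ivls" and G: "?G \<in> C_rd_ivl T a b positive_ivls"
    and FG: "?FG \<in> C_rd_ivl T a b positive_ivls"
    using assms p q by (auto intro!: C_rd_ivl_scale C_rd_ivl_powr C_rd_ivl_times)
  note int = F[THEN rd_continuous_IR_integrable] G[THEN rd_continuous_IR_integrable]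
    FG[THEN rd_continuous_IR_integrable]
  have h: "0 \<le> h s" and f: "0 \<le> lower (f s)" "0 \<le> upper (f s)"
    and g: "0 \<le> lower (g s)" "0 \<le> upper (g s)" if "s \<in> ts_Icc T a b" for s
    using that assms(5) C_rd_ivl_positiveD(3,4)[OF assms(6) that] C_rd_ivl_positiveD(3,4)[OF assms(7) that]
    by (auto simp: C_rd_def less_imp_le)
  have nonneg: "0 \<le> lower (IR_integral T a b ?F)" "0 \<le> lower (IR_integral T a b ?G)"
    using int C_rd_ivl_positiveD(3)[OF F] C_rd_ivl_positiveD(3)[OF G]
    by (blast intro: IR_integral_lower_nonneg less_imp_le)+
  have "lower (IR_integral T a b ?FG) \<le>
      lower (IR_integral T a b ?F) powr (1 / p) * lower (IR_integral T a b ?G) powr (1 / q)"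
  proof (rule tag_sum_limit_Holder[OF assms(9,8)])
    show "0 \<le> h s \<and> 0 \<le> lower (f s) \<and> 0 \<le> lower (g s)" if "s \<in> ts_Icc T a b" for s
      using h f g that by auto
  qed (rule iffD1[OF tag_sum_limit_cong IR_integral_tendsto(1)];
       simp add: int h f g p q lower_upper_times_nonneg)+
  moreover have "upper (IR_integral T a b ?FG) \<le>
      upper (IR_integral T a b ?F) powr (1 / p) * upper (IR_integral T a b ?G) powr (1 / q)"
  proof (rule tag_sum_limit_Holder[OF assms(9,8)])
    show "0 \<le> h s \<and> 0 \<le> upper (f s) \<and> 0 \<le> upper (g s)" if "s \<in> ts_Icc T a b" for s
      using h f g that by auto
  qed (rule iffD1[OF tag_sum_limit_cong IR_integral_tendsto(2)];
       simp add: int h f g p q lower_upper_times_nonneg)+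
  ultimately show ?thesis
    using int nonneg p q by (simp add: ivl_le_def lower_upper_times_nonneg)
qed

end
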